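(* Let $H$ be an infinite-dimensional complex Hilbert space and let $T\in\mathcal{AN}(H)$ be a $\ast$-paranormal operator. If $T$ is invertible (in $\mathcal{B}(H)$), then $T$ is normal.
   Context: $\mathcal{B}(H)$ denotes the bounded linear operators on $H$. An operator $T\in\mathcal{B}(H)$ is $\ast$-paranormal if $\|T^*x\|^2\le\|T^2x\|\,\|x\|$ for every $x\in H$. An operator $T$ is norm attaining if $\|Tx\|=\|T\|\|x\|$ for some nonzero $x$ in its domain space; $T\in\mathcal{B}(H)$ is absolutely norm attaining if $T|_M$ is norm attaining for every nonzero closed subspace $M\subseteq H$. $\mathcal{AN}(H)$ is the set of absolutely norm attaining operators in $\mathcal{B}(H)$. *)

theory Defs
  imports "HOL-Analysis.Analysis"
begin

class complex_vector = real_vector +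
  fixes scaleC :: "complex \<Rightarrow> 'a \<Rightarrow> 'a"  (infixr "*\<^sub>C" 75)
  assumes scaleC_add_right: "a *\<^sub>C (x + y) = a *\<^sub>C x + a *\<^sub>C y"
    and scaleC_add_left: "(a + b) *\<^sub>C x = a *\<^sub>C x + b *\<^sub>C x"
    and scaleC_scaleC: "a *\<^sub>C b *\<^sub>C x = (a * b) *\<^sub>C x"
    and scaleC_one: "1 *\<^sub>C x = x"
    and scaleR_scaleC: "r *\<^sub>R x = complex_of_real r *\<^sub>C x"

global_interpretation complex_vector: vector_space "scaleC :: complex \<Rightarrow> 'a \<Rightarrow> 'a::complex_vector"
  by standard (simp_all add: scaleC_add_right scaleC_add_left scaleC_scaleC scaleC_one)

text \<open>The inner product is linear in its first and conjugate linear in its second argument.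
  The metric and the topology of the space are the ones of the norm \<open>sqrt \<langle>x, x\<rangle>\<close>.\<close>

class complex_inner = complex_vector + real_normed_vector +
  fixes cinner :: "'a \<Rightarrow> 'a \<Rightarrow> complex"
  assumes cinner_commute: "cinner x y = cnj (cinner y x)"
    and cinner_add_left: "cinner (x + y) z = cinner x z + cinner y z"
    and cinner_scaleC_left: "cinner (a *\<^sub>C x) y = a * cinner x y"
    and cinner_ge_zero: "0 \<le> Re (cinner x x)"
    and cinner_eq_zero_iff: "cinner x x = 0 \<longleftrightarrow> x = 0"
    and norm_eq_sqrt_cinner: "norm x = sqrt (Re (cinner x x))"

class complex_hilbert_space = complex_inner + complete_space

definition infinite_dimensional :: "'a::complex_vector itself \<Rightarrow> bool" where
  "infinite_dimensional _ \<longleftrightarrow> \<not> (\<exists>B::'a set. finite B \<and> complex_vector.span B = UNIV)"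

definition bounded_clinear :: "('a::complex_inner \<Rightarrow> 'b::complex_inner) \<Rightarrow> bool" where
  "bounded_clinear f \<longleftrightarrow>
     Vector_Spaces.linear scaleC scaleC f \<and> (\<exists>K. \<forall>x. norm (f x) \<le> norm x * K)"

text \<open>For a bounded linear operator between Hilbert spaces, the adjoint exists and is unique by the
  Riesz representation theorem; for other functions the value carries no meaning.\<close>

definition cadjoint :: "('a::complex_hilbert_space \<Rightarrow> 'b::complex_hilbert_space) \<Rightarrow> 'b \<Rightarrow> 'a" where
  "cadjoint f = (SOME g. \<forall>x y. cinner (f x) y = cinner x (g y))"

definition star_paranormal :: "('a::complex_hilbert_space \<Rightarrow> 'a) \<Rightarrow> bool" where
  "star_paranormal T \<longleftrightarrow>
     bounded_clinear T \<and> (\<forall>x. (norm (cadjoint T x))\<^sup>2 \<le> norm (T (T x)) * norm x)"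

text \<open>Operator norm of the restriction of \<open>f\<close> to the subspace \<open>M\<close>, formed like \<^const>\<open>onorm\<close>,
  with which it agrees for \<open>M = UNIV\<close>. The vector \<open>0\<close> contributes \<open>0 / 0 = 0\<close> to the supremum.\<close>

definition onorm_on :: "'a::real_normed_vector set \<Rightarrow> ('a \<Rightarrow> 'b::real_normed_vector) \<Rightarrow> real" where
  "onorm_on M f = (SUP x\<in>M. norm (f x) / norm x)"

definition norm_attaining_on ::
    "'a::real_normed_vector set \<Rightarrow> ('a \<Rightarrow> 'b::real_normed_vector) \<Rightarrow> bool" where
  "norm_attaining_on M f \<longleftrightarrow> (\<exists>x\<in>M. x \<noteq> 0 \<and> norm (f x) = onorm_on M f * norm x)"

definition AN :: "('a::complex_hilbert_space \<Rightarrow> 'a) set" where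
  "AN = {T. bounded_clinear T \<and>
     (\<forall>M. complex_vector.subspace M \<and> closed M \<and> M \<noteq> {0} \<longrightarrow> norm_attaining_on M T)}"

definition invertible_op :: "('a::complex_hilbert_space \<Rightarrow> 'a) \<Rightarrow> bool" where
  "invertible_op T \<longleftrightarrow>
     bounded_clinear T \<and> (\<exists>S. bounded_clinear S \<and> S \<circ> T = id \<and> T \<circ> S = id)"

definition normal_op :: "('a::complex_hilbert_space \<Rightarrow> 'a) \<Rightarrow> bool" where
  "normal_op T \<longleftrightarrow> bounded_clinear T \<and> cadjoint T \<circ> T = T \<circ> cadjoint T"

end

theory Submission
  imports Defs
begin

text \<open>
  The largest subspace \<open>N\<close> on which \<open>T\<close> and its adjoint act as commuting operators reduces \<open>T\<close>; we show
  that \<open>L = orth N\<close> vanishes. Otherwise \<open>T\<close> attains its norm \<open>c\<close> on \<open>L\<close>, so the eigenspace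
  \<open>M = {x \<in> L. T\<^sup>*T x = c\<^sup>2 x}\<close> is nonzero, and *-paranormality gives \<open>T ` M \<subseteq> M\<close>. If \<open>T ` M = M\<close>,
  then \<open>T\<close> is a multiple of a unitary on \<open>M\<close> and \<open>M\<close> reduces \<open>T\<close>, which forces \<open>M \<subseteq> N\<close>, a
  contradiction. Equality holds since \<open>T\<close> is invertible and, by the absolute norm attaining property, \<open>M\<close>
  or its complement in \<open>L\<close> is finite-dimensional.
\<close>

section \<open>Complex inner product spaces\<close>

lemma cinner_add_right: "cinner x (y + z) = cinner x y + cinner x z"
  by (metis cinner_add_left cinner_commute complex_cnj_add)

lemma cinner_scaleC_right: "cinner x (a *\<^sub>C y) = cnj a * cinner x y"
  by (metis cinner_scaleC_left cinner_commute complex_cnj_mult)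

lemma cinner_zero_left [simp]: "cinner 0 x = 0"
  using cinner_add_left[of 0 0 x] by simp

lemma cinner_zero_right [simp]: "cinner x 0 = 0"
  using cinner_add_right[of x 0 0] by simp

lemma cinner_diff_left: "cinner (x - y) z = cinner x z - cinner y z"
  using cinner_add_left[of "x - y" y z] by simp

lemma cinner_diff_right: "cinner x (y - z) = cinner x y - cinner x z"
  using cinner_add_right[of x "y - z" z] by simp

lemma cinner_self: "cinner x x = complex_of_real ((norm x)\<^sup>2)"
proof -
  have "Im (cinner x x) = 0"
    using arg_cong[OF cinner_commute[of x x], of Im] by simp
  then show ?thesis
    by (simp add: complex_eq_iff norm_eq_sqrt_cinner cinner_ge_zero)
qed

lemma cinner_eq_0_commute: "cinner x y = 0 \<longleftrightarrow> cinner y x = 0"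
  by (metis cinner_commute complex_cnj_zero_iff)

lemma norm_scaleC: "norm (a *\<^sub>C x) = cmod a * norm (x::'a::complex_inner)"
proof -
  have "cinner (a *\<^sub>C x) (a *\<^sub>C x) = (a * cnj a) * cinner x x"
    by (simp add: cinner_scaleC_left cinner_scaleC_right)
  then have "complex_of_real ((norm (a *\<^sub>C x))\<^sup>2) = complex_of_real ((cmod a * norm x)\<^sup>2)"
    by (simp add: cinner_self power_mult_distrib flip: complex_norm_square)
  then show ?thesis
    by (simp add: power2_eq_iff_nonneg del: of_real_power)
qed

lemma norm_diff_scaleC_sq:
  "(norm (x - a *\<^sub>C y))\<^sup>2 = (norm x)\<^sup>2 - 2 * Re (cnj a * cinner x y) + (cmod a * norm y)\<^sup>2"
proof -
  have "cinner (x - a *\<^sub>C y) (x - a *\<^sub>C y)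
      = cinner x x - (cnj a * cinner x y + cnj (cnj a * cinner x y)) + cinner (a *\<^sub>C y) (a *\<^sub>C y)"
    by (simp add: cinner_diff_left cinner_diff_right cinner_scaleC_right cinner_scaleC_left
        cinner_commute[of y x] algebra_simps)
  then have "Re (cinner (x - a *\<^sub>C y) (x - a *\<^sub>C y))
      = Re (cinner x x) - 2 * Re (cnj a * cinner x y) + Re (cinner (a *\<^sub>C y) (a *\<^sub>C y))"
    by simp
  then show ?thesis
    by (simp only: cinner_self Re_complex_of_real norm_scaleC)
qed

text \<open>The coefficient is the one minimising the quadratic expansion of the squared distance
  from \<open>x\<close> to the line through \<open>y\<close>. The exact decrease in norm is what
  yields both the Cauchy-Schwarz inequality and the orthogonality of the residual in a closest-point
  problem.\<close>

lemma norm_sub_projection_sq: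
  assumes "y \<noteq> 0"
  shows "(norm (x - (cinner x y / (norm y)\<^sup>2) *\<^sub>C y))\<^sup>2 = (norm x)\<^sup>2 - (cmod (cinner x y) / norm y)\<^sup>2"
proof -
  let ?a = "cinner x y / complex_of_real ((norm y)\<^sup>2)"
  have "cnj ?a * cinner x y = complex_of_real ((cmod (cinner x y) / norm y)\<^sup>2)"
    using complex_norm_square[of "cinner x y"] by (simp add: power_divide mult.commute)
  moreover have "cmod ?a * norm y = cmod (cinner x y) / norm y"
    using assms by (simp add: norm_divide norm_power power2_eq_square norm_mult)
  ultimately show ?thesis
    by (simp add: norm_diff_scaleC_sq del: of_real_power of_real_divide)
qed

lemma Cauchy_Schwarz: "cmod (cinner x y) \<le> norm x * norm y"
proof (cases "y = 0")
  case False
  have "(cmod (cinner x y) / norm y)\<^sup>2 \<le> (norm x)\<^sup>2"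
    using norm_sub_projection_sq[OF False, of x]
    by (metis diff_ge_0_iff_ge zero_le_power2)
  then have "cmod (cinner x y) / norm y \<le> norm x"
    by (rule power2_le_imp_le) simp
  then show ?thesis
    using False by (simp add: divide_le_eq)
qed simp

lemma continuous_cinner_left: "continuous_on UNIV (\<lambda>x. cinner x y)"
proof -
  have "bounded_linear (\<lambda>x. cinner x y)"
    by (rule bounded_linear_intro[where K = "norm y"])
      (simp_all add: cinner_add_left scaleR_scaleC cinner_scaleC_left scaleR_conv_of_real
        Cauchy_Schwarz)
  then show ?thesis
    by (rule linear_continuous_on)
qed

lemma parallelogram_law:
  "(norm (x + y))\<^sup>2 + (norm (x - y))\<^sup>2 = 2 * (norm x)\<^sup>2 + 2 * (norm (y::'a::complex_inner))\<^sup>2"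
  using norm_diff_scaleC_sq[of x 1 y] norm_diff_scaleC_sq[of x "-1" y]
  by (simp add: scaleC_one complex_vector.scale_minus_left)

section \<open>Orthogonal complements, projections and the Riesz representation\<close>

definition orth :: "'a::complex_inner set \<Rightarrow> 'a set" where
  "orth M = {x. \<forall>y\<in>M. cinner x y = 0}"

lemma orthD: "x \<in> orth M \<Longrightarrow> y \<in> M \<Longrightarrow> cinner x y = 0"
  by (simp add: orth_def)

lemma subspace_orth: "complex_vector.subspace (orth M)"
  by (simp add: complex_vector.subspace_def orth_def cinner_add_left cinner_scaleC_left)

lemma closed_orth: "closed (orth M)"
proof -
  have "orth M = (\<Inter>y\<in>M. {x. cinner x y = 0})"
    by (auto simp: orth_def)
  then show ?thesis
    by (auto intro!: closed_INT closed_Collect_eq continuous_cinner_left continuous_on_const)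
qed

lemma orth_disjoint: "x \<in> M \<Longrightarrow> x \<in> orth M \<Longrightarrow> x = 0"
  using cinner_eq_zero_iff orthD by blast

text \<open>A sequence in \<open>M\<close> minimising the distance to \<open>x\<close> is Cauchy by
  the parallelogram law; completeness and closedness give a closest point \<open>m\<close>, and
  minimality makes \<open>x - m\<close> orthogonal to \<open>M\<close>.\<close>

lemma orthogonal_projection:
  fixes M :: "'a::complex_hilbert_space set"
  assumes M: "complex_vector.subspace M" and "closed M"
  obtains m where "m \<in> M" "x - m \<in> orth M"
proof -
  define D where "D = (INF m\<in>M. (norm (x - m))\<^sup>2)"
  have "0 \<in> M"
    using M by (rule complex_vector.subspace_0)
  have bdd: "bdd_below ((\<lambda>m. (norm (x - m))\<^sup>2) ` M)"
    by (rule bdd_belowI[where m = 0]) auto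
  have D_le: "D \<le> (norm (x - m))\<^sup>2" if "m \<in> M" for m
    unfolding D_def by (rule cINF_lower[OF bdd that])
  have "\<exists>m\<in>M. (norm (x - m))\<^sup>2 < D + inverse (real (Suc n))" for n
    using cINF_less_iff[OF _ bdd, of "D + inverse (real (Suc n))"] \<open>0 \<in> M\<close>
    by (auto simp: D_def)
  then obtain f where f: "\<And>n. f n \<in> M" "\<And>n. (norm (x - f n))\<^sup>2 < D + inverse (real (Suc n))"
    by metis
  have close: "(norm (f n - f k))\<^sup>2 \<le> 2 * inverse (real (Suc n)) + 2 * inverse (real (Suc k))" for n k
  proof -
    \<comment> \<open>The midpoint of \<open>f n\<close> and \<open>f k\<close> cannot be closer to
      \<open>x\<close> than the infimum allows. The parallelogram law turns this lower bound into an
      upper bound on the distance from \<open>f n\<close> to \<open>f k\<close>.\<close>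
    have mid: "(1/2::complex) *\<^sub>C (f n + f k) \<in> M"
      using M f(1) by (simp add: complex_vector.subspace_add complex_vector.subspace_scale)
    have "(x - f n) + (x - f k) = (2::complex) *\<^sub>C (x - (1/2::complex) *\<^sub>C (f n + f k))"
      using scaleC_add_left[of 1 1 x]
      by (simp add: complex_vector.scale_right_diff_distrib scaleC_scaleC scaleC_one)
    then have "(norm ((x - f n) + (x - f k)))\<^sup>2 \<ge> 4 * D"
      using D_le[OF mid] by (simp add: norm_scaleC power_mult_distrib)
    then show ?thesis
      using parallelogram_law[of "x - f n" "x - f k"] f(2)[of n] f(2)[of k]
      by (simp add: norm_minus_commute)
  qed
  have "Cauchy f"
  proof (rule metric_CauchyI)
    fix e :: real assume "0 < e"
    then obtain N where N: "inverse (real (Suc N)) < e\<^sup>2 / 4"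
      using reals_Archimedean[of "e\<^sup>2 / 4"] by auto
    have "dist (f n) (f k) < e" if "n \<ge> N" "k \<ge> N" for n k
    proof -
      have "inverse (real (Suc n)) \<le> inverse (real (Suc N))"
        "inverse (real (Suc k)) \<le> inverse (real (Suc N))"
        using that by (simp_all add: le_imp_inverse_le)
      then have "(norm (f n - f k))\<^sup>2 < e\<^sup>2"
        using close[of n k] N by linarith
      then show ?thesis
        using \<open>0 < e\<close> by (simp add: dist_norm power_less_imp_less_base)
    qed
    then show "\<exists>N. \<forall>n\<ge>N. \<forall>k\<ge>N. dist (f n) (f k) < e"
      by blast
  qed
  then obtain m where m: "f \<longlonglongrightarrow> m"
    by (auto simp: Cauchy_convergent_iff convergent_def)
  have "m \<in> M"
    using closed_sequentially[OF \<open>closed M\<close>] f(1) m by blast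
  have "(norm (x - m))\<^sup>2 \<le> D"
  proof (rule LIMSEQ_le)
    show "(\<lambda>n. (norm (x - f n))\<^sup>2) \<longlonglongrightarrow> (norm (x - m))\<^sup>2"
      by (intro tendsto_intros m)
    show "(\<lambda>n. D + inverse (real (Suc n))) \<longlonglongrightarrow> D"
      by (rule LIMSEQ_inverse_real_of_nat_add)
    show "\<exists>N. \<forall>n\<ge>N. (norm (x - f n))\<^sup>2 \<le> D + inverse (real (Suc n))"
      using f(2) less_imp_le by blast
  qed
  have "cinner (x - m) y = 0" if "y \<in> M" for y
  proof (cases "y = 0")
    case False
    \<comment> \<open>Shifting \<open>m\<close> by the optimal multiple of \<open>y\<close> would
      lower the squared distance below \<open>D\<close> unless the inner product vanishes.\<close>
    let ?a = "cinner (x - m) y / complex_of_real ((norm y)\<^sup>2)"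
    have "m + ?a *\<^sub>C y \<in> M"
      using M \<open>m \<in> M\<close> that by (simp add: complex_vector.subspace_add complex_vector.subspace_scale)
    then have "D \<le> (norm (x - m - ?a *\<^sub>C y))\<^sup>2"
      using D_le by (metis diff_diff_eq)
    then have "(cmod (cinner (x - m) y) / norm y)\<^sup>2 \<le> 0"
      using norm_sub_projection_sq[OF False, of "x - m"] \<open>(norm (x - m))\<^sup>2 \<le> D\<close>
      by linarith
    then show ?thesis
      using False by simp
  qed simp
  then have "x - m \<in> orth M"
    by (simp add: orth_def)
  with \<open>m \<in> M\<close> show ?thesis
    by (rule that)
qed

text \<open>A nonzero functional has a closed proper kernel. A nonzero vector \<open>w\<close>
  orthogonal to it represents the functional up to a scalar, since each \<open>x\<close> differs
  from a multiple of \<open>w\<close> by an element of the kernel.\<close>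

lemma Riesz_representation:
  fixes \<phi> :: "'a::complex_hilbert_space \<Rightarrow> complex"
  assumes add: "\<And>x y. \<phi> (x + y) = \<phi> x + \<phi> y" and scale: "\<And>a x. \<phi> (a *\<^sub>C x) = a * \<phi> x"
    and cont: "continuous_on UNIV \<phi>"
  obtains z where "\<And>x. \<phi> x = cinner x z"
proof (cases "\<forall>x. \<phi> x = 0")
  case True
  then show ?thesis
    using that[of 0] by simp
next
  case False
  then obtain u where u: "\<phi> u \<noteq> 0"
    by blast
  have \<phi>0: "\<phi> 0 = 0"
    using add[of 0 0] by simp
  have diff: "\<phi> (x - y) = \<phi> x - \<phi> y" for x y
    using add[of "x - y" y] by simp
  define K where "K = {x. \<phi> x = 0}"
  have "complex_vector.subspace K"
    by (simp add: K_def complex_vector.subspace_def add scale \<phi>0)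
  moreover have "closed K"
    unfolding K_def by (intro closed_Collect_eq cont continuous_on_const)
  ultimately obtain m where m: "m \<in> K" "u - m \<in> orth K"
    by (rule orthogonal_projection)
  define w where "w = u - m"
  have \<phi>w: "\<phi> w \<noteq> 0"
    using m u by (simp add: w_def diff K_def)
  then have "w \<noteq> 0"
    using \<phi>0 by auto
  have "\<phi> x = cinner x ((cnj (\<phi> w) / complex_of_real ((norm w)\<^sup>2)) *\<^sub>C w)" for x
  proof -
    have "x - (\<phi> x / \<phi> w) *\<^sub>C w \<in> K"
      using \<phi>w by (simp add: K_def diff scale)
    then have "cinner (x - (\<phi> x / \<phi> w) *\<^sub>C w) w = 0"
      using m(2) orthD cinner_eq_0_commute unfolding w_def by blast
    then have "cinner x w = \<phi> x / \<phi> w * complex_of_real ((norm w)\<^sup>2)"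
      by (simp add: cinner_diff_left cinner_scaleC_left cinner_self)
    then show ?thesis
      using \<phi>w \<open>w \<noteq> 0\<close> by (simp add: cinner_scaleC_right)
  qed
  then show ?thesis
    by (rule that)
qed

section \<open>Bounded operators and adjoints\<close>

lemma bounded_clinear_add: "bounded_clinear f \<Longrightarrow> f (x + y) = f x + f y"
  by (simp add: bounded_clinear_def Vector_Spaces.linear_iff)

lemma bounded_clinear_scaleC: "bounded_clinear f \<Longrightarrow> f (a *\<^sub>C x) = a *\<^sub>C f x"
  by (simp add: bounded_clinear_def Vector_Spaces.linear_iff)

lemma bounded_clinear_diff: "bounded_clinear f \<Longrightarrow> f (x - y) = f x - f y"
  using bounded_clinear_add[of f "x - y" y] by simp

lemma bounded_clinear_zero: "bounded_clinear f \<Longrightarrow> f 0 = 0"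
  using bounded_clinear_add[of f 0 0] by simp

lemma bounded_clinear_bounded_linear:
  assumes "bounded_clinear f"
  shows "bounded_linear f"
proof -
  obtain K where "\<And>x. norm (f x) \<le> norm x * K"
    using assms by (auto simp: bounded_clinear_def)
  then show ?thesis
    by (rule bounded_linear_intro[rotated 2])
      (simp_all add: assms bounded_clinear_add bounded_clinear_scaleC scaleR_scaleC)
qed

lemma continuous_bounded_clinear: "bounded_clinear f \<Longrightarrow> continuous_on S f"
  by (intro linear_continuous_on bounded_clinear_bounded_linear)

lemma bounded_clinear_comp:
  assumes "bounded_clinear f" "bounded_clinear g"
  shows "bounded_clinear (\<lambda>x. f (g x))"
proof -
  have "bounded_linear (\<lambda>x. f (g x))"
    by (rule bounded_linear_compose[OF assms[THEN bounded_clinear_bounded_linear]])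
  then show ?thesis
    unfolding bounded_clinear_def Vector_Spaces.linear_iff
    by (auto simp: assms bounded_clinear_add bounded_clinear_scaleC
        complex_vector.vector_space_axioms dest: bounded_linear.bounded)
qed

text \<open>Riesz representation at each fixed \<open>y\<close> shows that some function satisfies
  the defining equation, so the choice in \<open>cadjoint\<close> returns a genuine adjoint.\<close>

lemma cadjoint_cinner:
  assumes "bounded_clinear f"
  shows "cinner (f x) y = cinner x (cadjoint f y)"
proof -
  have "\<exists>z. \<forall>x. cinner (f x) y = cinner x z" for y
  proof -
    have "continuous_on UNIV (\<lambda>x. cinner (f x) y)"
      using continuous_on_compose2[OF continuous_cinner_left continuous_bounded_clinear[OF assms]]
      by blast
    then show ?thesis
      using Riesz_representation[of "\<lambda>x. cinner (f x) y"]
      by (auto simp: assms bounded_clinear_add bounded_clinear_scaleC cinner_add_left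
          cinner_scaleC_left)
  qed
  then have "\<exists>g. \<forall>x y. cinner (f x) y = cinner x (g y)"
    by metis
  then show ?thesis
    unfolding cadjoint_def by (rule someI2_ex) blast
qed

lemma cadjoint_cinner_left: "bounded_clinear f \<Longrightarrow> cinner (cadjoint f x) y = cinner x (f y)"
  by (metis cadjoint_cinner cinner_commute)

lemma cinner_extensionality:
  assumes "\<And>x. cinner x y = cinner x z"
  shows "y = z"
  using assms[of "y - z"] cinner_eq_zero_iff[of "y - z"] by (simp add: cinner_diff_right)

text \<open>The squared norm of \<open>cadjoint f y\<close> equals the inner product of
  \<open>f (cadjoint f y)\<close> with \<open>y\<close>, to which Cauchy-Schwarz applies. Bounding
  \<open>f\<close> at this single vector allows a \<open>c\<close> that bounds \<open>f\<close>
  merely on an invariant subspace.\<close>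

lemma norm_cadjoint_le:
  assumes "bounded_clinear f" "0 \<le> c" "norm (f (cadjoint f y)) \<le> c * norm (cadjoint f y)"
  shows "norm (cadjoint f y) \<le> c * norm y"
proof (cases "cadjoint f y = 0")
  case True
  then show ?thesis
    using assms(2) by simp
next
  case False
  have "(norm (cadjoint f y))\<^sup>2 = cmod (cinner (f (cadjoint f y)) y)"
    by (simp add: assms(1) cadjoint_cinner cinner_self norm_power)
  also have "\<dots> \<le> c * norm (cadjoint f y) * norm y"
    using Cauchy_Schwarz assms(3) by (meson mult_right_mono norm_ge_zero order_trans)
  finally show ?thesis
    using False by (simp add: power2_eq_square mult.assoc mult.left_commute)
qed

lemma bounded_clinear_cadjoint:
  assumes f: "bounded_clinear f"
  shows "bounded_clinear (cadjoint f)"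
proof -
  obtain K where K: "K \<ge> 0" "\<And>x. norm (f x) \<le> K * norm x"
    using bounded_linear.nonneg_bounded[OF bounded_clinear_bounded_linear[OF f]]
    by (metis mult.commute)
  have "cadjoint f (x + y) = cadjoint f x + cadjoint f y" for x y
    by (rule cinner_extensionality) (simp add: cinner_add_right flip: cadjoint_cinner[OF f])
  moreover have "cadjoint f (a *\<^sub>C x) = a *\<^sub>C cadjoint f x" for a x
    by (rule cinner_extensionality) (simp add: cinner_scaleC_right flip: cadjoint_cinner[OF f])
  moreover have "norm (cadjoint f x) \<le> norm x * K" for x
    using norm_cadjoint_le[OF f K] by (simp add: mult.commute)
  ultimately show ?thesis
    unfolding bounded_clinear_def Vector_Spaces.linear_iff
    by (auto intro: complex_vector.vector_space_axioms)
qed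

section \<open>Finite-dimensional subspaces\<close>

text \<open>The image of a basis of \<open>S\<close> is independent and has the same cardinality. A
  vector of \<open>S\<close> outside its span would yield more independent vectors than the
  dimension permits.\<close>

lemma finite_dim_injective_surjective:
  assumes S: "complex_vector.subspace S" and B: "finite B" "S \<subseteq> complex_vector.span B"
    and f: "bounded_clinear f" and "f ` S \<subseteq> S" and ker: "\<And>x. x \<in> S \<Longrightarrow> f x = 0 \<Longrightarrow> x = 0"
  shows "f ` S = S"
proof -
  interpret f: Vector_Spaces.linear scaleC scaleC f
    using f by (simp add: bounded_clinear_def)
  obtain C where C: "C \<subseteq> S" "complex_vector.independent C" "S \<subseteq> complex_vector.span C"
    using complex_vector.maximal_independent_subset by blast
  have spanC: "complex_vector.span C = S"
    using C S by (simp add: complex_vector.span_minimal subset_antisym)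
  have "finite C"
    using complex_vector.independent_span_bound[OF B(1) C(2)] C(1) B(2) by blast
  have inj: "inj_on f S"
    by (rule inj_onI)
      (metis S bounded_clinear_diff complex_vector.subspace_diff eq_iff_diff_eq_0 f ker)
  have ind: "complex_vector.independent (f ` C)"
    using f.independent_inj_on_image C(2) inj spanC by blast
  have card: "card (f ` C) = card C"
    using card_image inj C(1) inj_on_subset by blast
  have "S \<subseteq> complex_vector.span (f ` C)"
  proof (rule ccontr)
    assume "\<not> S \<subseteq> complex_vector.span (f ` C)"
    then obtain v where v: "v \<in> S" "v \<notin> complex_vector.span (f ` C)"
      by blast
    then have "complex_vector.independent (insert v (f ` C))"
      using ind by (simp add: complex_vector.independent_insert)
    moreover have "insert v (f ` C) \<subseteq> complex_vector.span C"
      using v(1) C(1) \<open>f ` S \<subseteq> S\<close> spanC by blast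
    ultimately have "card (insert v (f ` C)) \<le> card C"
      using complex_vector.independent_span_bound \<open>finite C\<close> by blast
    moreover have "v \<notin> f ` C"
      using v(2) by (metis complex_vector.span_base)
    ultimately show False
      using \<open>finite C\<close> card by simp
  qed
  then show ?thesis
    using f.span_image[of C] spanC \<open>f ` S \<subseteq> S\<close> by blast
qed

text \<open>This is Gram-Schmidt, one vector at a time, and so applies in any inner product space,
  with no appeal to completeness.\<close>

lemma finite_span_projection:
  fixes B :: "'a::complex_inner set"
  assumes "finite B"
  shows "\<exists>m\<in>complex_vector.span B. x - m \<in> orth B"
  using assms
proof (induction B arbitrary: x)
  case empty
  then show ?case
    by (simp add: orth_def)
next
  case (insert b B)
  obtain p where p: "p \<in> complex_vector.span B" "b - p \<in> orth B"
    using insert.IH by blast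
  obtain q where q: "q \<in> complex_vector.span B" "x - q \<in> orth B"
    using insert.IH by blast
  have sub: "complex_vector.span B \<subseteq> complex_vector.span (insert b B)"
    by (rule complex_vector.span_mono) blast
  have span_orth: "cinner z y = 0" if "z \<in> orth B" "y \<in> complex_vector.span B" for z y
  proof -
    have "complex_vector.span B \<subseteq> orth {z}"
      using that(1) by (intro complex_vector.span_minimal subspace_orth)
        (auto simp: orth_def cinner_eq_0_commute[of z])
    then show ?thesis
      using that(2) cinner_eq_0_commute by (auto simp: orth_def)
  qed
  \<comment> \<open>If \<open>b\<close> already lies in the span of \<open>B\<close>, then
    \<open>b - p\<close> is zero and division by zero makes \<open>a\<close> equal to 0, which is
    the right coefficient in that case.\<close>
  define a where "a = cinner (x - q) (b - p) / cinner (b - p) (b - p)"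
  define m where "m = q + a *\<^sub>C (b - p)"
  have "b \<in> complex_vector.span (insert b B)"
    by (simp add: complex_vector.span_base)
  then have "m \<in> complex_vector.span (insert b B)"
    unfolding m_def using p(1) q(1) sub
    by (meson complex_vector.span_add complex_vector.span_diff complex_vector.span_scale subset_iff)
  moreover have xm: "x - m = (x - q) - a *\<^sub>C (b - p)"
    by (simp add: m_def)
  have B: "x - m \<in> orth B"
    unfolding xm
    by (intro complex_vector.subspace_diff complex_vector.subspace_scale subspace_orth p q)
  have "cinner (x - m) (b - p) = 0"
    by (cases "b - p = 0")
      (simp_all add: xm a_def cinner_diff_left[of "x - q"] cinner_scaleC_left cinner_eq_zero_iff)
  then have "cinner (x - m) b = 0"
    using span_orth[OF B p(1)] by (simp add: cinner_diff_right)
  with B have "x - m \<in> orth (insert b B)"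
    by (simp add: orth_def)
  ultimately show ?case
    by blast
qed

text \<open>Finitely many vectors of \<open>S\<close> never span it, so a further unit vector of
  \<open>S\<close> orthogonal to all earlier ones can always be chosen.\<close>

lemma infinite_dim_orthonormal_sequence:
  fixes S :: "'a::complex_inner set"
  assumes S: "complex_vector.subspace S"
    and inf: "\<nexists>B. finite B \<and> S \<subseteq> complex_vector.span B"
  obtains e :: "nat \<Rightarrow> 'a" where "\<And>n. e n \<in> S" "\<And>i j. cinner (e i) (e j) = (if i = j then 1 else 0)"
proof -
  have step: "\<exists>x\<in>S. norm x = 1 \<and> x \<in> orth B" if B: "finite B" "B \<subseteq> S" for B
  proof -
    obtain x where x: "x \<in> S" "x \<notin> complex_vector.span B"
      using inf B(1) by blast
    obtain m where m: "m \<in> complex_vector.span B" "x - m \<in> orth B"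
      using finite_span_projection[OF B(1)] by blast
    have "m \<in> S"
      using m(1) complex_vector.span_minimal[OF B(2) S] by blast
    then have "x - m \<in> S"
      using S x(1) by (simp add: complex_vector.subspace_diff)
    moreover have "x - m \<noteq> 0"
      using m(1) x(2) by auto
    ultimately show ?thesis
      using m(2) S subspace_orth[of B]
      by (intro bexI[where x = "complex_of_real (inverse (norm (x - m))) *\<^sub>C (x - m)"])
        (auto simp: norm_scaleC norm_inverse intro!: complex_vector.subspace_scale
          simp del: of_real_inverse)
  qed
  \<comment> \<open>\<open>P f n r\<close> depends on \<open>f\<close> only below \<open>n\<close>,
    as choice along the well-founded order \<open>less_than\<close> requires.\<close>
  define P where "P = (\<lambda>(f :: nat \<Rightarrow> 'a) n r. r \<in> S \<and> norm r = 1 \<and> r \<in> orth (f ` {..<n}))"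
  have "\<exists>f. \<forall>n. P f n (f n)"
  proof (rule dependent_wf_choice[OF wf_less_than])
    show "P f n r = P g n r" if "\<And>k. (k, n) \<in> less_than \<Longrightarrow> f k = g k" for f g n r
      using that by (simp add: P_def orth_def)
    show "\<exists>r. P f n r" if "\<And>k. (k, n) \<in> less_than \<Longrightarrow> P f k (f k)" for f n
      using step[of "f ` {..<n}"] that by (auto simp: P_def)
  qed
  then obtain e where "\<And>n. P e n (e n)"
    by blast
  then have e: "\<And>n. e n \<in> S" "\<And>n. norm (e n) = 1" "\<And>n. e n \<in> orth (e ` {..<n})"
    by (simp_all add: P_def)
  have "cinner (e i) (e j) = (if i = j then 1 else 0)" for i j
    using orthD[OF e(3)[of i], of "e j"] orthD[OF e(3)[of j], of "e i"] cinner_eq_0_commute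
    by (cases i j rule: linorder_cases) (auto simp: cinner_self e(2))
  with e(1) show ?thesis
    by (rule that)
qed

section \<open>Absolutely norm attaining operators\<close>

lemma norm_le_onorm_on:
  assumes "bounded_clinear T" "x \<in> M"
  shows "norm (T x) \<le> onorm_on M T * norm x"
proof (cases "x = 0")
  case True
  then show ?thesis
    by (simp add: assms(1) bounded_clinear_zero)
next
  case False
  obtain K where K: "K \<ge> 0" "\<And>x. norm (T x) \<le> norm x * K"
    using bounded_linear.nonneg_bounded[OF bounded_clinear_bounded_linear[OF assms(1)]] by blast
  have "norm (T y) / norm y \<le> K" for y
    using K by (cases "y = 0") (simp_all add: divide_le_eq mult.commute)
  then have "bdd_above ((\<lambda>x. norm (T x) / norm x) ` M)"
    by (intro bdd_aboveI2)
  then have "norm (T x) / norm x \<le> onorm_on M T"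
    unfolding onorm_on_def using assms(2) by (rule cSUP_upper[rotated])
  then show ?thesis
    using False by (simp add: divide_le_eq)
qed

text \<open>If both \<open>M\<close> and \<open>L \<inter> orth M\<close> had orthonormal sequences \<open>e\<close> and \<open>f\<close>, then \<open>T\<close> would have norm
  \<open>c\<close> on the closed span of the vectors \<open>e n + f n / (n + 1)\<close>, which meets \<open>M\<close> only in \<open>0\<close>.\<close>

lemma AN_finite_dim_or_codim:
  assumes "T \<in> AN" and L: "complex_vector.subspace L" "closed L"
    and M: "complex_vector.subspace M" "M \<subseteq> L"
    and le: "\<And>x. x \<in> L \<Longrightarrow> norm (T x) \<le> c * norm x"
    and eq: "\<And>x. x \<in> L \<Longrightarrow> norm (T x) = c * norm x \<longleftrightarrow> x \<in> M"
  shows "(\<exists>B. finite B \<and> M \<subseteq> complex_vector.span B) \<or>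
    (\<exists>B. finite B \<and> L \<inter> orth M \<subseteq> complex_vector.span B)"
proof (rule ccontr)
  assume contr: "\<not> ?thesis"
  have T: "bounded_clinear T"
    using assms(1) by (simp add: AN_def)
  obtain e :: "nat \<Rightarrow> 'a" where e: "\<And>n. e n \<in> M"
    "\<And>i j. cinner (e i) (e j) = (if i = j then 1 else 0)"
    using infinite_dim_orthonormal_sequence[OF M(1)] contr by blast
  obtain f :: "nat \<Rightarrow> 'a" where f: "\<And>n. f n \<in> L \<inter> orth M"
    "\<And>i j. cinner (f i) (f j) = (if i = j then 1 else 0)"
    using infinite_dim_orthonormal_sequence[OF complex_vector.subspace_inter[OF L(1) subspace_orth]]
      contr by blast
  have norm1: "norm (e n) = 1" "norm (f n) = 1" for n
    using e(2)[of n n] f(2)[of n n] by (simp_all add: norm_eq_sqrt_cinner)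
  have fM: "cinner (f n) y = 0" "cinner y (f n) = 0" if "y \<in> M" for n y
    using f(1) that orthD cinner_eq_0_commute by blast+
  define t where "t n = inverse (real (Suc n))" for n
  \<comment> \<open>Describing \<open>G\<close> by equations makes closedness immediate. It contains
    every \<open>g n\<close> but may exceed their closed span, as the part orthogonal to
    \<open>M\<close> and to every \<open>f n\<close> is left free; what matters is that
    \<open>G\<close> still meets \<open>M\<close> only in 0.\<close>
  define G where "G = {g \<in> L. (\<forall>n. cinner g (f n) = complex_of_real (t n) * cinner g (e n)) \<and>
    g \<in> orth (M \<inter> orth (range e))}"
  define g where "g n = e n + complex_of_real (t n) *\<^sub>C f n" for n
  have subspaceG: "complex_vector.subspace G"
    using L(1) subspace_orth[of "M \<inter> orth (range e)"]
    by (simp add: G_def complex_vector.subspace_def cinner_add_left cinner_scaleC_left algebra_simps)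
  have "G = L \<inter> (\<Inter>n. {g. cinner g (f n) = complex_of_real (t n) * cinner g (e n)}) \<inter>
      orth (M \<inter> orth (range e))"
    by (auto simp: G_def)
  then have closedG: "closed G"
    by (auto intro!: closed_Int closed_INT closed_Collect_eq continuous_cinner_left
        continuous_on_mult continuous_on_const L(2) closed_orth)
  have gG: "g n \<in> G" for n
  proof -
    have "g n \<in> L"
      using L(1) M(2) e(1) f(1) unfolding g_def
      by (intro complex_vector.subspace_add complex_vector.subspace_scale) auto
    moreover have "cinner (g n) (f k) = complex_of_real (t k) * cinner (g n) (e k)" for k
      by (simp add: g_def cinner_add_left cinner_scaleC_left e f fM)
    moreover have "cinner (g n) y = 0" if "y \<in> M" "y \<in> orth (range e)" for y
      using that by (simp add: g_def cinner_add_left cinner_scaleC_left fM orth_def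
          cinner_eq_0_commute[of "e n"])
    ultimately show ?thesis
      by (simp add: G_def orth_def[of "M \<inter> _"])
  qed
  \<comment> \<open>On \<open>M\<close> all coefficients along \<open>f n\<close> vanish, hence so
    do those along \<open>e n\<close>, because \<open>t n\<close> is nonzero. Such a vector lies in
    \<open>M \<inter> orth (range e)\<close> and is also orthogonal to that set.\<close>
  have GM: "x = 0" if "x \<in> G" "x \<in> M" for x
  proof -
    have "cinner x (e n) = 0" for n
      using that fM(2)[of x n] by (simp add: G_def t_def del: of_nat_Suc)
    then have "x \<in> orth (range e)"
      by (auto simp: orth_def)
    then show ?thesis
      using that orth_disjoint[of x "M \<inter> orth (range e)"] by (simp add: G_def)
  qed
  have "cinner (g 0) (e 0) = 1"
    by (simp add: g_def cinner_add_left cinner_scaleC_left e fM)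
  then have "g 0 \<noteq> 0"
    by auto
  then have "G \<noteq> {0}"
    using gG[of 0] by auto
  then have "norm_attaining_on G T"
    using assms(1) subspaceG closedG by (simp add: AN_def)
  then obtain x where x: "x \<in> G" "x \<noteq> 0" "norm (T x) = onorm_on G T * norm x"
    by (auto simp: norm_attaining_on_def)
  have "c \<ge> 0"
    using eq[of "e 0"] e(1)[of 0] M(2) norm1 by (metis mult.right_neutral norm_ge_zero subsetD)
  have "onorm_on G T \<ge> 0"
    using x norm_ge_zero[of "T x"] by (simp add: zero_le_mult_iff del: norm_ge_zero)
  \<comment> \<open>The vector \<open>g n\<close> is within \<open>t n\<close> of the unit vector
    \<open>e n\<close>, at which \<open>T\<close> has norm \<open>c\<close>. Letting
    \<open>t n\<close> tend to 0 shows that the norm of \<open>T\<close> on \<open>G\<close> is at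
    least \<open>c\<close>, which forces a norm attaining vector of \<open>G\<close> into
    \<open>M\<close>.\<close>
  have lower: "c * (1 - t n) \<le> onorm_on G T * (1 + t n)" for n
  proof -
    have "t n \<ge> 0"
      by (simp add: t_def)
    have "norm (T (e n)) = c"
      using eq[of "e n"] e(1)[of n] M(2) norm1 by auto
    moreover have "norm (T (f n)) \<le> c"
      using le[of "f n"] f(1)[of n] norm1 by simp
    moreover have "T (e n) = T (g n) - complex_of_real (t n) *\<^sub>C T (f n)"
      using T by (simp add: g_def bounded_clinear_add bounded_clinear_scaleC)
    then have "norm (T (e n)) \<le> norm (T (g n)) + t n * norm (T (f n))"
      using norm_triangle_ineq4[of "T (g n)" "complex_of_real (t n) *\<^sub>C T (f n)"] \<open>t n \<ge> 0\<close>
      by (simp add: norm_scaleC)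
    ultimately have "c \<le> norm (T (g n)) + t n * c"
      using \<open>t n \<ge> 0\<close> by (smt (verit) mult_left_mono)
    moreover have "norm (T (g n)) \<le> onorm_on G T * norm (g n)"
      using T gG by (rule norm_le_onorm_on)
    moreover have "norm (g n) \<le> 1 + t n"
      using norm_triangle_ineq[of "e n" "complex_of_real (t n) *\<^sub>C f n"] \<open>t n \<ge> 0\<close>
      by (simp add: g_def norm_scaleC norm1)
    then have "onorm_on G T * norm (g n) \<le> onorm_on G T * (1 + t n)"
      using \<open>onorm_on G T \<ge> 0\<close> by (rule mult_left_mono)
    ultimately show ?thesis
      by (simp add: algebra_simps)
  qed
  have "t \<longlonglongrightarrow> 0"
    unfolding t_def by (rule LIMSEQ_inverse_real_of_nat)
  then have "(\<lambda>n. c * (1 - t n)) \<longlonglongrightarrow> c * (1 - 0)" "(\<lambda>n. onorm_on G T * (1 + t n)) \<longlonglongrightarrow> onorm_on G T * (1 + 0)"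
    by (intro tendsto_intros; assumption)+
  then have "c \<le> onorm_on G T"
    using LIMSEQ_le lower by fastforce
  then have "norm (T x) \<ge> c * norm x"
    using x(3) by (simp add: mult_right_mono)
  moreover have "x \<in> L"
    using x(1) by (simp add: G_def)
  ultimately have "x \<in> M"
    using le[of x] eq[of x] by simp
  then show False
    using GM x by blast
qed


section \<open>Reducing subspaces\<close>

text \<open>For a maximising \<open>y\<close>, expanding the squared norm of
  \<open>cadjoint T (T y) - c^2 y\<close> gives at most 0, as the adjoint is also bounded by
  \<open>c\<close> on \<open>L\<close>. The maximising vectors thus form an eigenspace, in
  particular a subspace.\<close>

lemma norm_maximum_iff_eigenvector:
  assumes T: "bounded_clinear T" and "0 \<le> c"
    and L: "T ` L \<subseteq> L" "cadjoint T ` L \<subseteq> L"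
    and le: "\<And>x. x \<in> L \<Longrightarrow> norm (T x) \<le> c * norm x" and "y \<in> L"
  shows "norm (T y) = c * norm y \<longleftrightarrow> cadjoint T (T y) = complex_of_real (c\<^sup>2) *\<^sub>C y"
proof
  assume y: "norm (T y) = c * norm y"
  have "norm (cadjoint T (T y)) \<le> c * norm (T y)"
    using L \<open>y \<in> L\<close> by (intro norm_cadjoint_le[OF T \<open>0 \<le> c\<close>] le) blast
  then have "(norm (cadjoint T (T y)))\<^sup>2 \<le> (c * (c * norm y))\<^sup>2"
    unfolding y by (rule power_mono) simp
  moreover have "cinner (cadjoint T (T y)) y = complex_of_real ((c * norm y)\<^sup>2)"
    using y by (simp only: cadjoint_cinner_left[OF T] cinner_self)
  then have "Re (cnj (complex_of_real (c\<^sup>2)) * cinner (cadjoint T (T y)) y) = (c * (c * norm y))\<^sup>2"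
    by (simp add: power_mult_distrib power2_eq_square[of "c\<^sup>2"] flip: of_real_mult of_real_power)
  moreover have "(cmod (complex_of_real (c\<^sup>2)) * norm y)\<^sup>2 = (c * (c * norm y))\<^sup>2"
    by (simp add: norm_mult power2_eq_square)
  ultimately have "(norm (cadjoint T (T y) - complex_of_real (c\<^sup>2) *\<^sub>C y))\<^sup>2 \<le> 0"
    unfolding norm_diff_scaleC_sq by linarith
  then show "cadjoint T (T y) = complex_of_real (c\<^sup>2) *\<^sub>C y"
    by simp
next
  assume y: "cadjoint T (T y) = complex_of_real (c\<^sup>2) *\<^sub>C y"
  have "complex_of_real ((norm (T y))\<^sup>2) = cinner (cadjoint T (T y)) y"
    by (simp only: cadjoint_cinner_left[OF T] cinner_self)
  also have "\<dots> = complex_of_real ((c * norm y)\<^sup>2)"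
    unfolding y by (simp add: cinner_scaleC_left cinner_self power_mult_distrib)
  finally show "norm (T y) = c * norm y"
    using \<open>0 \<le> c\<close> by (simp add: power2_eq_iff_nonneg del: of_real_power)
qed

lemma reducing_subspace_contains_normal_part:
  assumes AN: "T \<in> AN" and par: "star_paranormal T" and inj: "\<And>x. T x = 0 \<Longrightarrow> x = 0"
    and surj: "surj T"
    and L: "complex_vector.subspace L" "closed L" "L \<noteq> {0}"
    and TL: "T ` L = L" and AL: "cadjoint T ` L \<subseteq> L"
  obtains M where "M \<subseteq> L" "\<exists>x\<in>M. x \<noteq> 0" "T ` M \<subseteq> M" "cadjoint T ` M \<subseteq> M"
    "\<And>x. x \<in> M \<Longrightarrow> cadjoint T (T x) = T (cadjoint T x)"
proof -
  have T: "bounded_clinear T"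
    using AN by (simp add: AN_def)
  have A: "bounded_clinear (cadjoint T)"
    using T by (rule bounded_clinear_cadjoint)
  define c where "c = onorm_on L T"
  have le: "norm (T x) \<le> c * norm x" if "x \<in> L" for x
    unfolding c_def using T that by (rule norm_le_onorm_on)
  have "norm_attaining_on L T"
    using AN L by (simp add: AN_def)
  then obtain x0 where x0: "x0 \<in> L" "x0 \<noteq> 0" "norm (T x0) = c * norm x0"
    by (auto simp: norm_attaining_on_def c_def)
  have "0 < norm (T x0)"
    using x0(2) inj by auto
  then have "0 < c"
    using x0 by (simp add: zero_less_mult_iff)
  define M where "M = {x \<in> L. cadjoint T (T x) = complex_of_real (c\<^sup>2) *\<^sub>C x}"
  have eq: "norm (T x) = c * norm x \<longleftrightarrow> x \<in> M" if "x \<in> L" for x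
    using norm_maximum_iff_eigenvector[OF T _ _ AL le that] \<open>0 < c\<close> TL that by (simp add: M_def)
  have "M \<subseteq> L"
    by (auto simp: M_def)
  have subspaceM: "complex_vector.subspace M"
    using L(1) by (simp add: M_def complex_vector.subspace_def T A bounded_clinear_add
        bounded_clinear_scaleC bounded_clinear_zero scaleC_add_right scaleC_scaleC mult.commute)
  have closedM: "closed M"
  proof -
    have "bounded_clinear (\<lambda>x. complex_of_real (c\<^sup>2) *\<^sub>C x :: 'a)"
      by (auto simp: bounded_clinear_def Vector_Spaces.linear_iff scaleC_add_right scaleC_scaleC mult.commute
          norm_scaleC norm_power intro!: complex_vector.vector_space_axioms exI[of _ "c\<^sup>2"])
    then have "closed {x. cadjoint T (T x) = complex_of_real (c\<^sup>2) *\<^sub>C x}"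
      by (rule closed_Collect_eq[OF continuous_bounded_clinear[OF bounded_clinear_comp[OF A T]]
            continuous_bounded_clinear])
    moreover have "M = L \<inter> {x. cadjoint T (T x) = complex_of_real (c\<^sup>2) *\<^sub>C x}"
      by (auto simp: M_def)
    ultimately show ?thesis
      using L(2) by (simp add: closed_Int)
  qed
  \<comment> \<open>The inequality of *-paranormality is applied at \<open>T x\<close>, giving
    \<open>c^4 |x|^2 \<le> |T^3 x| |T x|\<close>. Bounding \<open>T^3 x\<close> by
    \<open>c |T^2 x|\<close> and cancelling leaves \<open>c |T x| \<le> |T^2 x|\<close>, so
    \<open>T x\<close> is again maximising.\<close>
  have TM: "T ` M \<subseteq> M"
  proof clarify
    fix x assume x: "x \<in> M"
    then have xL: "x \<in> L" "T x \<in> L" "T (T x) \<in> L"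
      using \<open>M \<subseteq> L\<close> TL by blast+
    have Tx: "norm (T x) = c * norm x"
      using eq x xL by blast
    have "norm (cadjoint T (T x)) = c\<^sup>2 * norm x"
      using x by (simp add: M_def norm_scaleC norm_power)
    then have "(c\<^sup>2 * norm x)\<^sup>2 \<le> norm (T (T (T x))) * (c * norm x)"
      using par Tx unfolding star_paranormal_def by metis
    also have "\<dots> \<le> c * norm (T (T x)) * (c * norm x)"
      using le[OF xL(3)] \<open>0 < c\<close> by (intro mult_right_mono) auto
    finally have "(c\<^sup>2 * norm x) * (c\<^sup>2 * norm x) \<le> (c\<^sup>2 * norm x) * norm (T (T x))"
      by (simp add: power2_eq_square mult_ac)
    then have "c * norm (T x) \<le> norm (T (T x))"
      using \<open>0 < c\<close> Tx by (cases "x = 0") (auto simp: power2_eq_square mult.assoc)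
    then show "T x \<in> M"
      using le[OF xL(2)] eq[OF xL(2)] by simp
  qed
  have "M \<subseteq> T ` M"
  proof -
    consider B where "finite B" "M \<subseteq> complex_vector.span B"
      | B where "finite B" "L \<inter> orth M \<subseteq> complex_vector.span B"
      using AN_finite_dim_or_codim[OF AN L(1,2) subspaceM \<open>M \<subseteq> L\<close> le eq] by blast
    then show ?thesis
    proof cases
      case 1
      then show ?thesis
        using finite_dim_injective_surjective[OF subspaceM _ _ T TM] inj by blast
    next
      case 2
      let ?P = "L \<inter> orth M"
      \<comment> \<open>Invariance of \<open>M\<close> under \<open>T\<close> passes to invariance
        of its complement in \<open>L\<close> under the adjoint. The adjoint is injective because
        \<open>T\<close> is surjective, hence it is onto the finite-dimensional
        \<open>?P\<close>.\<close>
      have "cadjoint T ` ?P \<subseteq> ?P"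
        using AL TM by (fastforce simp: orth_def cadjoint_cinner_left[OF T])
      moreover have "x = 0" if "cadjoint T x = 0" for x
      proof -
        obtain y where "x = T y"
          using surj by (metis surjD)
        then show ?thesis
          using cadjoint_cinner[OF T, of y x] that cinner_eq_zero_iff by auto
      qed
      ultimately have AP: "cadjoint T ` ?P = ?P"
        using finite_dim_injective_surjective[OF complex_vector.subspace_inter[OF L(1) subspace_orth] 2 A]
        by blast
      show ?thesis
      proof
        fix y assume "y \<in> M"
        then obtain x where x: "x \<in> L" "y = T x"
          using \<open>M \<subseteq> L\<close> TL by blast
        obtain m where m: "m \<in> M" "x - m \<in> orth M"
          using orthogonal_projection[OF subspaceM closedM] by blast
        have "x - m \<in> ?P"
          using L(1) m \<open>M \<subseteq> L\<close> x(1) by (auto intro: complex_vector.subspace_diff)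
        then obtain q where q: "q \<in> ?P" "x - m = cadjoint T q"
          using AP by blast
        \<comment> \<open>The squared norm of \<open>x - m\<close>, written as
          \<open>cadjoint T q\<close>, is the inner product of \<open>q\<close> with
          \<open>T (x - m)\<close>. The former is orthogonal to \<open>M\<close> and the latter lies
          in \<open>M\<close>, so \<open>x\<close> equals \<open>m\<close>.\<close>
        have "T (x - m) \<in> M"
          using \<open>y \<in> M\<close> TM m(1) subspaceM unfolding x(2)
          by (auto simp: bounded_clinear_diff[OF T] intro: complex_vector.subspace_diff)
        then have "cinner q (T (x - m)) = 0"
          using q(1) orthD by blast
        then have "cinner (x - m) (x - m) = 0"
          by (metis cadjoint_cinner_left[OF T] q(2))
        then show "y \<in> T ` M"
          using m(1) x(2) by (simp add: cinner_eq_zero_iff)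
      qed
    qed
  qed
  have AT: "cadjoint T (T x) = complex_of_real (c\<^sup>2) *\<^sub>C x" if "x \<in> M" for x
    using that by (simp add: M_def)
  show ?thesis
  proof
    show "\<exists>x\<in>M. x \<noteq> 0"
      using x0 eq by blast
    \<comment> \<open>Writing \<open>y = T x\<close> with \<open>x\<close> in \<open>M\<close>, the
      adjoint sends \<open>y\<close> to \<open>c^2 x\<close>, again in \<open>M\<close>. Applying
      \<open>T\<close> gives \<open>c^2 y\<close>, which is also \<open>cadjoint T (T y)\<close>;
      this settles the commutation below.\<close>
    show "cadjoint T ` M \<subseteq> M"
    proof clarify
      fix y assume "y \<in> M"
      then obtain x where "x \<in> M" "y = T x"
        using \<open>M \<subseteq> T ` M\<close> by blast
      then show "cadjoint T y \<in> M"
        using AT subspaceM by (simp add: complex_vector.subspace_scale)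
    qed
    show "cadjoint T (T y) = T (cadjoint T y)" if y: "y \<in> M" for y
    proof -
      obtain x where "x \<in> M" "y = T x"
        using \<open>M \<subseteq> T ` M\<close> y by blast
      then show ?thesis
        using AT[OF y] AT[of x] by (simp add: bounded_clinear_scaleC[OF T])
    qed
  qed (use \<open>M \<subseteq> L\<close> TM in auto)
qed

section \<open>The largest reducing subspace on which the operator is normal\<close>

fun word :: "('a::complex_hilbert_space \<Rightarrow> 'a) \<Rightarrow> bool list \<Rightarrow> 'a \<Rightarrow> 'a" where
  "word T [] x = x"
| "word T (b # w) x = word T w (if b then T x else cadjoint T x)"

text \<open>The commutator of \<open>T\<close> and its adjoint must vanish along the whole orbit of
  \<open>x\<close> under products of the two. As an intersection of kernels of bounded operators,
  this is visibly a closed subspace. Since \<open>word\<close> applies its first letter first,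
  prefixing a letter to a word gives invariance at once.\<close>

definition normal_part :: "('a::complex_hilbert_space \<Rightarrow> 'a) \<Rightarrow> 'a set" where
  "normal_part T = {x. \<forall>w. cadjoint T (T (word T w x)) = T (cadjoint T (word T w x))}"

lemma normal_part_commutes: "x \<in> normal_part T \<Longrightarrow> cadjoint T (T x) = T (cadjoint T x)"
  unfolding normal_part_def by (metis (mono_tags, lifting) mem_Collect_eq word.simps(1))

lemma normal_part_invariant:
  assumes "x \<in> normal_part T"
  shows "T x \<in> normal_part T" "cadjoint T x \<in> normal_part T"
proof -
  have "cadjoint T (T (word T (b # w) x)) = T (cadjoint T (word T (b # w) x))" for b w
    using assms unfolding normal_part_def by blast
  from this[of True] this[of False] show "T x \<in> normal_part T" "cadjoint T x \<in> normal_part T"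
    by (simp_all add: normal_part_def)
qed

lemma normal_part_greatest:
  assumes "T ` M \<subseteq> M" "cadjoint T ` M \<subseteq> M"
    and "\<And>x. x \<in> M \<Longrightarrow> cadjoint T (T x) = T (cadjoint T x)"
  shows "M \<subseteq> normal_part T"
proof
  fix x assume "x \<in> M"
  then have "word T w x \<in> M" for w
    using assms(1,2) by (induction w arbitrary: x) auto
  then show "x \<in> normal_part T"
    using assms(3) by (simp add: normal_part_def)
qed

lemma bounded_clinear_word:
  assumes "bounded_clinear T"
  shows "bounded_clinear (word T w)"
proof (induction w)
  case Nil
  show ?case
    by (auto simp: bounded_clinear_def Vector_Spaces.linear_iff complex_vector.vector_space_axioms
        intro!: exI[of _ 1])
next
  case (Cons b w)
  have "bounded_clinear (if b then T else cadjoint T)"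
    using assms bounded_clinear_cadjoint[OF assms] by simp
  from bounded_clinear_comp[OF Cons this]
  have "bounded_clinear (\<lambda>x. word T w ((if b then T else cadjoint T) x))" .
  moreover have "word T (b # w) = (\<lambda>x. word T w ((if b then T else cadjoint T) x))"
    by (simp add: fun_eq_iff)
  ultimately show ?case
    by (simp only:)
qed

lemma
  assumes T: "bounded_clinear T"
  shows subspace_normal_part: "complex_vector.subspace (normal_part T)"
    and closed_normal_part: "closed (normal_part T)"
proof -
  note A = bounded_clinear_cadjoint[OF T]
  note W = bounded_clinear_word[OF T]
  show "complex_vector.subspace (normal_part T)"
    by (simp add: normal_part_def complex_vector.subspace_def T A W bounded_clinear_add
        bounded_clinear_scaleC bounded_clinear_zero)
  have "closed {x. cadjoint T (T (word T w x)) = T (cadjoint T (word T w x))}" for w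
    by (rule closed_Collect_eq[OF
          continuous_bounded_clinear[OF bounded_clinear_comp[OF A bounded_clinear_comp[OF T W]]]
          continuous_bounded_clinear[OF bounded_clinear_comp[OF T bounded_clinear_comp[OF A W]]]])
  moreover have "normal_part T =
      (\<Inter>w. {x. cadjoint T (T (word T w x)) = T (cadjoint T (word T w x))})"
    by (auto simp: normal_part_def)
  ultimately show "closed (normal_part T)"
    by (simp add: closed_INT)
qed

theorem theorem3p14:
  fixes T :: "'a::complex_hilbert_space \<Rightarrow> 'a"
  assumes "infinite_dimensional TYPE('a)"
    and "T \<in> AN"
    and "star_paranormal T"
    and "invertible_op T"
  shows "normal_op T"
proof -
  have T: "bounded_clinear T"
    using assms(2) by (simp add: AN_def)
  obtain S where S: "\<And>x. S (T x) = x" "\<And>x. T (S x) = x"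
    using assms(4) unfolding invertible_op_def by (metis comp_apply id_apply)
  have inj: "x = 0" if "T x = 0" for x
    using S(1) that bounded_clinear_zero[OF T] by metis
  have surj: "surj T"
    using S(2) by (metis surjI)
  let ?N = "normal_part T"
  let ?L = "orth ?N"
  note N = subspace_normal_part[OF T] closed_normal_part[OF T]
  have L_invariant: "T x \<in> ?L" "cadjoint T x \<in> ?L" if "x \<in> ?L" for x
    using that
    by (auto simp: orth_def cadjoint_cinner[OF T] cadjoint_cinner_left[OF T] normal_part_invariant)
  \<comment> \<open>Invariance alone gives one inclusion. For the other, the preimage
    \<open>S y\<close> is split along \<open>?N\<close> and \<open>?L\<close>; its component
    \<open>n\<close> satisfies \<open>T n \<in> ?N\<close> and \<open>T n \<in> ?L\<close>, so it
    vanishes by injectivity.\<close>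
  have TL: "T ` ?L = ?L"
  proof
    show "?L \<subseteq> T ` ?L"
    proof
      fix y assume y: "y \<in> ?L"
      obtain n where n: "n \<in> ?N" "S y - n \<in> ?L"
        using orthogonal_projection[OF N] by blast
      have "T n = y - T (S y - n)"
        by (simp add: bounded_clinear_diff[OF T] S(2))
      then have "T n \<in> ?L"
        using y n(2) L_invariant(1) subspace_orth by (metis complex_vector.subspace_diff)
      then have "n = 0"
        using n(1) normal_part_invariant(1) orth_disjoint inj by blast
      then show "y \<in> T ` ?L"
        using n(2) S(2) by (metis diff_zero image_eqI)
    qed
  qed (use L_invariant in blast)
  \<comment> \<open>Otherwise \<open>?L\<close> contains a nontrivial invariant \<open>M\<close> on
    which \<open>T\<close> commutes with its adjoint. Maximality of \<open>?N\<close> absorbs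
    \<open>M\<close>, although \<open>M\<close> is orthogonal to \<open>?N\<close>.\<close>
  have "?L = {0}"
  proof (rule ccontr)
    assume "?L \<noteq> {0}"
    then obtain M where M: "M \<subseteq> ?L" "\<exists>x\<in>M. x \<noteq> 0" "T ` M \<subseteq> M" "cadjoint T ` M \<subseteq> M"
      "\<And>x. x \<in> M \<Longrightarrow> cadjoint T (T x) = T (cadjoint T x)"
      using reducing_subspace_contains_normal_part[OF assms(2,3) inj surj subspace_orth closed_orth]
        TL L_invariant by (metis image_subsetI)
    have "M \<subseteq> ?N"
      using M(3-5) by (rule normal_part_greatest)
    then show False
      using M(1,2) orth_disjoint[of _ ?N] by (meson subsetD)
  qed
  then have "x \<in> ?N" for x
    using orthogonal_projection[OF N, of x] by (metis eq_iff_diff_eq_0 singletonD)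
  then show ?thesis
    using T normal_part_commutes by (auto simp: normal_op_def fun_eq_iff)
qed

end
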